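(* Work in ZFC and assume ESS, i.e. that there exists a strongly summable ultrafilter on $\mathbb{Z}$. Let $P\in\mathbb{Z}[x_1,\dots,x_m]$ be a linear homogeneous polynomial and let $\sigma\in\mathbb{Z}^{<\omega}$ be a reduced string. The following facts are equivalent: (1) for all (additively) idempotent ultrafilters $\mathcal{U}\in\beta\mathbb{Z}$, $\sigma\mathcal{U}\models P(x_1,\dots,x_m)=0$; (2) there exists a strongly summable ultrafilter $\mathcal{U}\in\beta\mathbb{Z}$ such that $\sigma\mathcal{U}\models P(x_1,\dots,x_m)=0$; (3) $P$ has a solution in $\mathfrak{G}(\sigma)$.
   Context: $\beta\mathbb{Z}$ is the set of all ultrafilters on $\mathbb{Z}$ (Čech–Stone compactification of the discrete space $\mathbb{Z}$), with addition $A\in\mathcal{U}+\mathcal{V}\iff\{n\in\mathbb{Z}:\{k\in\mathbb{Z}:n+k\in A\}\in\mathcal{V}\}\in\mathcal{U}$; $\mathcal{U}$ is (additively) idempotent if $\mathcal{U}+\mathcal{U}=\mathcal{U}$. For $a\in\mathbb{Z}$, $a\,\mathcal{U}$ is the ultrafilter with $A\in a\,\mathcal{U}\iff\{n: an\in A\}\in\mathcal{U}$. For an ultrafilter $\mathcal{V}\in\beta\mathbb{Z}$, $\mathcal{V}\models P(x_1,\dots,x_m)=0$ means: for every $A\in\mathcal{V}$ there exist $b_1,\dots,b_m\in A$ with $P(b_1,\dots,b_m)=0$. Strongly summable ultrafilter on $\mathbb{Z}$: an ultrafilter $\mathcal{U}\in\beta\mathbb{Z}$ such that for every $A\in\mathcal{U}$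 there is an injective sequence $(x_n)_{n\in\mathbb{N}}$ of integers with $\mathrm{FS}((x_n)_{n\in\mathbb{N}})\subseteq A$ and $\mathrm{FS}((x_n)_{n\in\mathbb{N}})\in\mathcal{U}$, where $\mathrm{FS}((x_n)_{n})=\{\sum_{n\in F}x_n: F\subseteq\mathbb{N}\text{ finite non-empty}\}$. $\mathbb{Z}^{<\omega}=\bigcup_{k\ge 0}\mathbb{Z}^k$ is the set of finite strings of integers (including the empty string). For $\sigma=(a_1,\dots,a_n)$, $\sigma\,\mathcal{U}=a_1\mathcal{U}+\dots+a_n\mathcal{U}$ (the empty sum being the principal ultrafilter at $0$). A string $(a_1,\dots,a_n)$ is reduced if all $a_i\ne0$ and $a_i\ne a_{i+1}$ for $1\le i\le n-1$. $\approx$ is the smallest equivalence relation on $\mathbb{Z}^{<\omega}$ such that: the empty string is equivalent to $(0)$; $(a)\approx(a,a)$ for every $a\in\mathbb{Z}$; and $\sigma\approx\sigma'$, $\tau\approx\tau'$ imply $\sigma\tau\approx\sigma'\tau'$ (concatenation). $\mathfrak{G}(\sigma)$ is the $\approx$-equivalence class of $\sigma$. For $P=\sum_{i=1}^m c_ix_i$ linear homogeneous with integer coefficients, $P$ (or the equation $P=0$) has a solution in $\mathfrak{G}(\sigma)$ if there are strings $\sigma_1,\dots,\sigma_m\in\mathfrak{G}(\sigma)$ all of the same length such that $\sum_{i=1}^m c_i\sigma_i=0$, where operations on strings are componentwise and $0$ is the all-zero string. *)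

theory Defs
  imports Main
begin

definition ultrafilter :: "'a filter \<Rightarrow> bool" where
  "ultrafilter U \<longleftrightarrow> U \<noteq> bot \<and> (\<forall>P. eventually P U \<or> eventually (\<lambda>x. \<not> P x) U)"

text \<open>A set \<open>A\<close> belongs to a filter \<open>U\<close> iff \<open>\<forall>\<^sub>F x in U. x \<in> A\<close>.\<close>

definition uf_plus :: "int filter \<Rightarrow> int filter \<Rightarrow> int filter"  (infixl \<open>\<oplus>\<^sub>u\<close> 65) where
  "U \<oplus>\<^sub>u V = Abs_filter (\<lambda>P. \<forall>\<^sub>F n in U. \<forall>\<^sub>F k in V. P (n + k))"

lemma eventually_uf_plus:
  "eventually P (U \<oplus>\<^sub>u V) \<longleftrightarrow> (\<forall>\<^sub>F n in U. \<forall>\<^sub>F k in V. P (n + k))"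
  unfolding uf_plus_def
proof (rule eventually_Abs_filter, rule is_filter.intro)
  show "\<forall>\<^sub>F n in U. \<forall>\<^sub>F k in V. True" by simp
next
  fix P Q :: "int \<Rightarrow> bool"
  assume "\<forall>\<^sub>F n in U. \<forall>\<^sub>F k in V. P (n + k)" "\<forall>\<^sub>F n in U. \<forall>\<^sub>F k in V. Q (n + k)"
  then show "\<forall>\<^sub>F n in U. \<forall>\<^sub>F k in V. P (n + k) \<and> Q (n + k)"
    by eventually_elim (rule eventually_conj)
next
  fix P Q :: "int \<Rightarrow> bool"
  assume *: "\<forall>x. P x \<longrightarrow> Q x" and "\<forall>\<^sub>F n in U. \<forall>\<^sub>F k in V. P (n + k)"
  from this(2) show "\<forall>\<^sub>F n in U. \<forall>\<^sub>F k in V. Q (n + k)"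
    by eventually_elim (use * in \<open>auto elim: eventually_mono\<close>)
qed

lemma mem_uf_plus:
  "(\<forall>\<^sub>F x in U \<oplus>\<^sub>u V. x \<in> A) \<longleftrightarrow> (\<forall>\<^sub>F n in U. n \<in> {n. \<forall>\<^sub>F k in V. k \<in> {k. n + k \<in> A}})"
  by (simp add: eventually_uf_plus)

lemma ultrafilter_uf_plus:
  assumes "ultrafilter U" "ultrafilter V"
  shows "ultrafilter (U \<oplus>\<^sub>u V)"
proof -
  have U: "eventually P U \<or> (\<forall>\<^sub>F x in U. \<not> P x)" and V: "eventually P V \<or> (\<forall>\<^sub>F x in V. \<not> P x)"
    for P using assms by (auto simp: ultrafilter_def)
  have "\<not> eventually (\<lambda>_. False) U" "\<not> eventually (\<lambda>_. False) V"
    using assms by (auto simp: ultrafilter_def trivial_limit_def)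
  then have nb: "U \<oplus>\<^sub>u V \<noteq> bot"
    unfolding trivial_limit_def eventually_uf_plus by simp
  have "(\<forall>\<^sub>F n in U. \<forall>\<^sub>F k in V. P (n + k)) \<or> (\<forall>\<^sub>F n in U. \<forall>\<^sub>F k in V. \<not> P (n + k))" for P
    using U[of "\<lambda>n. \<forall>\<^sub>F k in V. P (n + k)"]
  proof
    assume "\<forall>\<^sub>F n in U. \<not> (\<forall>\<^sub>F k in V. P (n + k))"
    then have "\<forall>\<^sub>F n in U. \<forall>\<^sub>F k in V. \<not> P (n + k)"
      by eventually_elim (use V in blast)
    then show ?thesis ..
  qed simp
  then show ?thesis
    using nb by (auto simp: ultrafilter_def eventually_uf_plus)
qed

definition uf_scale :: "int \<Rightarrow> int filter \<Rightarrow> int filter" where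
  "uf_scale a U = filtermap (\<lambda>n. a * n) U"

lemma ultrafilter_uf_scale: "ultrafilter U \<Longrightarrow> ultrafilter (uf_scale a U)"
  by (auto simp: ultrafilter_def uf_scale_def eventually_filtermap filtermap_bot_iff)

definition uf_idempotent :: "int filter \<Rightarrow> bool" where
  "uf_idempotent U \<longleftrightarrow> U \<oplus>\<^sub>u U = U"

lemma uf_plus_zero [simp]: "U \<oplus>\<^sub>u principal {0} = U" "principal {0} \<oplus>\<^sub>u U = U"
  by (simp_all add: filter_eq_iff eventually_uf_plus eventually_principal)

lemma uf_plus_assoc: "(U \<oplus>\<^sub>u V) \<oplus>\<^sub>u W = U \<oplus>\<^sub>u (V \<oplus>\<^sub>u W)"
  by (simp add: filter_eq_iff eventually_uf_plus add.assoc)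

text \<open>By \<open>uf_plus_zero\<close> the final summand \<open>principal {0}\<close> is only visible
  for the empty string.\<close>

primrec string_uf :: "int list \<Rightarrow> int filter \<Rightarrow> int filter" where
  "string_uf [] U = principal {0}"
| "string_uf (a # \<sigma>) U = uf_scale a U \<oplus>\<^sub>u string_uf \<sigma> U"

lemma ultrafilter_string_uf: "ultrafilter U \<Longrightarrow> ultrafilter (string_uf \<sigma> U)"
proof (induction \<sigma>)
  case Nil
  show ?case by (simp add: ultrafilter_def eventually_principal principal_eq_bot_iff)
qed (simp add: ultrafilter_uf_plus ultrafilter_uf_scale)

lemma string_uf_append: "string_uf (\<sigma> @ \<tau>) U = string_uf \<sigma> U \<oplus>\<^sub>u string_uf \<tau> U"
  by (induction \<sigma>) (simp_all add: uf_plus_assoc)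

text \<open>\<open>P\<close> is a function of the variables \<open>x\<^sub>0, \<dots>, x\<^sub>m\<^sub>-\<^sub>1\<close>; it should not depend on
  the values of its argument at indices \<open>\<ge> m\<close>.\<close>

definition uf_models :: "int filter \<Rightarrow> nat \<Rightarrow> ((nat \<Rightarrow> int) \<Rightarrow> int) \<Rightarrow> bool" where
  "uf_models V m P \<longleftrightarrow>
     (\<forall>A. (\<forall>\<^sub>F x in V. x \<in> A) \<longrightarrow> (\<exists>b. (\<forall>i<m. b i \<in> A) \<and> P b = 0))"

definition linear_form :: "nat \<Rightarrow> (nat \<Rightarrow> int) \<Rightarrow> (nat \<Rightarrow> int) \<Rightarrow> int" where
  "linear_form m c x = (\<Sum>i<m. c i * x i)"

definition FS :: "(nat \<Rightarrow> int) \<Rightarrow> int set" where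
  "FS x = {\<Sum>n\<in>F. x n |F. finite F \<and> F \<noteq> {}}"

definition strongly_summable :: "int filter \<Rightarrow> bool" where
  "strongly_summable U \<longleftrightarrow> ultrafilter U \<and>
     (\<forall>A. (\<forall>\<^sub>F x in U. x \<in> A) \<longrightarrow>
        (\<exists>x :: nat \<Rightarrow> int. inj x \<and> FS x \<subseteq> A \<and> (\<forall>\<^sub>F y in U. y \<in> FS x)))"

definition reduced :: "int list \<Rightarrow> bool" where
  "reduced \<sigma> \<longleftrightarrow> (\<forall>i<length \<sigma>. \<sigma> ! i \<noteq> 0) \<and> (\<forall>i. Suc i < length \<sigma> \<longrightarrow> \<sigma> ! i \<noteq> \<sigma> ! Suc i)"

inductive str_equiv :: "int list \<Rightarrow> int list \<Rightarrow> bool"  (infix \<open>\<approx>\<^sub>s\<close> 50) where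
  empty_zero: "[] \<approx>\<^sub>s [0]"
| dup: "[a] \<approx>\<^sub>s [a, a]"
| append: "\<sigma> \<approx>\<^sub>s \<sigma>' \<Longrightarrow> \<tau> \<approx>\<^sub>s \<tau>' \<Longrightarrow> \<sigma> @ \<tau> \<approx>\<^sub>s \<sigma>' @ \<tau>'"
| refl: "\<sigma> \<approx>\<^sub>s \<sigma>"
| sym: "\<sigma> \<approx>\<^sub>s \<tau> \<Longrightarrow> \<tau> \<approx>\<^sub>s \<sigma>"
| trans: "\<sigma> \<approx>\<^sub>s \<tau> \<Longrightarrow> \<tau> \<approx>\<^sub>s \<rho> \<Longrightarrow> \<sigma> \<approx>\<^sub>s \<rho>"

definition str_class :: "int list \<Rightarrow> int list set" where
  "str_class \<sigma> = {\<tau>. \<sigma> \<approx>\<^sub>s \<tau>}"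

definition has_solution_in_class :: "nat \<Rightarrow> (nat \<Rightarrow> int) \<Rightarrow> int list \<Rightarrow> bool" where
  "has_solution_in_class m c \<sigma> \<longleftrightarrow>
     (\<exists>(s :: nat \<Rightarrow> int list) l.
        (\<forall>i<m. s i \<in> str_class \<sigma> \<and> length (s i) = l) \<and>
        (\<forall>j<l. (\<Sum>i<m. c i * s i ! j) = 0))"

end

theory Submission
  imports Defs "HOL-Computational_Algebra.Primes" "HOL-Library.Infinite_Set"
begin

text \<open>
  The equivalence \<open>\<approx>\<^sub>s\<close> is generated by identities that hold for every idempotent:
  \<open>a\<U> + a\<U> = a\<U>\<close>, and \<open>0\<U>\<close> is the neutral element. Hence all strings in the class of
  \<open>\<sigma>\<close> name the same ultrafilter \<open>\<sigma>\<U>\<close>. If strings \<open>\<sigma>\<^sub>i\<close> of common length in this class satisfy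
  \<open>\<Sum>c\<^sub>i\<sigma>\<^sub>i = 0\<close>, then for \<open>\<U>\<close>-generic \<open>n\<^sub>1, n\<^sub>2, \<dots>\<close> the numbers \<open>b\<^sub>i = \<Sum>\<^sub>j \<sigma>\<^sub>i(j) n\<^sub>j\<close> lie in a
  prescribed set of \<open>\<sigma>\<U>\<close> and solve the equation (\<open>uf_models_if_solution\<close>).

  The other direction rests on one fact about strongly summable \<open>\<U>\<close>
  (\<open>strongly_summable_thin\<close>): for every odd prime \<open>q\<close>, each set of \<open>\<U>\<close> contains \<open>FS(x)\<close> for a
  sequence \<open>x\<close> whose \<open>q\<close>-adic valuations increase strictly and all of whose tails generate sets
  \<open>FS(x\<^sub>k, x\<^sub>k\<^sub>+\<^sub>1, \<dots>)\<close> in \<open>\<U>\<close>. The valuations are made distinct by colouring an integer with its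
  last nonzero digit in base \<open>q\<close>: two terms of equal valuation and equal colour \<open>c\<close> would have a
  sum of colour \<open>2c \<noteq> c\<close>. The tails are in \<open>\<U>\<close> because they are cut out of \<open>FS(x)\<close> by
  divisibility by a power of \<open>q\<close>, and the nonzero ideals of \<open>\<int>\<close> are in \<open>\<U>\<close>. Membership of the tails
  makes \<open>\<U>\<close> idempotent.

  It also shows that \<open>\<U>\<close>-generic elements of \<open>\<sigma>\<U>\<close> have the form \<open>\<Sum>\<^sub>j w(j) x\<^sub>j\<close> with
  \<open>w \<approx>\<^sub>s \<sigma>\<close> (\<open>eventually_word_values\<close>). A solution of the equation among these is a relation
  \<open>\<Sum>\<^sub>j d\<^sub>j x\<^sub>j = 0\<close> whose coefficients \<open>d\<^sub>j = \<Sum>\<^sub>i c\<^sub>i w\<^sub>i(j)\<close> are bounded in terms of \<open>c\<close> and \<open>\<sigma>\<close>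
  alone. If \<open>q\<close> was chosen beyond that bound, distinctness of the valuations forces all \<open>d\<^sub>j\<close> to
  vanish (\<open>thin_sequence_independent\<close>), and the \<open>w\<^sub>i\<close> solve the equation in the class.
\<close>

section \<open>Integer sequences with increasing valuations\<close>

text \<open>A nonzero coefficient smaller than \<open>q\<close> leaves the valuation of its term unchanged, so among the
  terms with such coefficients the one of least valuation is cancelled by no other term modulo the
  next power of \<open>q\<close>. Divisibility by \<open>q ^ N\<close> in place of vanishing of
  the sum makes the lemma serve for cutting off tails of \<open>FS x\<close> as well.\<close>

lemma thin_sequence_independent:
  fixes q :: int and x d :: "nat \<Rightarrow> int"
  assumes q: "prime q" and mono: "strict_mono (\<lambda>n. multiplicity q (x n))"
    and nz: "\<And>n. x n \<noteq> 0" and F: "finite F" and d: "\<And>j. j \<in> F \<Longrightarrow> \<bar>d j\<bar> < q"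
    and dvd: "q ^ N dvd (\<Sum>j\<in>F. d j * x j)"
    and i: "i \<in> F" "multiplicity q (x i) < N"
  shows "d i = 0"
proof (rule ccontr)
  define e where "e n = multiplicity q (x n)" for n
  define B where "B = {j \<in> F. e j < N \<and> d j \<noteq> 0}"
  assume "d i \<noteq> 0"
  then have B: "finite B" "B \<noteq> {}"
    using F i by (auto simp: B_def e_def)
  define j where "j = Min B"
  have "j \<in> B" using B by (simp add: j_def)
  then have j: "j \<in> F" "e j < N" "d j \<noteq> 0" by (auto simp: B_def)
  have "q ^ Suc (e j) dvd d k * x k" if k: "k \<in> F - {j}" for k
  proof (cases "d k = 0")
    case False
    have "e j < e k"
    proof (cases "e k < N")
      case True
      with k False have "k \<in> B" by (auto simp: B_def)
      then have "j \<le> k" using B(1) by (simp add: j_def)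
      then have "j < k" using k by simp
      then show ?thesis using mono by (simp add: strict_mono_def e_def)
    qed (use j in simp)
    then have "q ^ Suc (e j) dvd x k"
      by (intro multiplicity_dvd') (simp add: e_def)
    then show ?thesis by (rule dvd_mult)
  qed simp
  then have "q ^ Suc (e j) dvd (\<Sum>k\<in>F - {j}. d k * x k)"
    by (rule dvd_sum)
  moreover have "q ^ Suc (e j) dvd (\<Sum>k\<in>F. d k * x k)"
    using j(2) by (intro dvd_trans[OF _ dvd] le_imp_power_dvd) simp
  ultimately have "q ^ Suc (e j) dvd d j * x j"
    using F j(1) by (simp add: sum.remove dvd_add_left_iff)
  then have "Suc (e j) \<le> multiplicity q (d j * x j)"
    using q nz j(3) by (intro multiplicity_geI) (auto simp: not_prime_unit)
  moreover have "\<not> q dvd d j"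
    using d[OF j(1)] j(3) dvd_imp_le_int[of "d j" q] by force
  ultimately show False
    using q by (simp add: e_def multiplicity_prime_elem_times_other[OF prime_imp_prime_elem])
qed

lemma FS_permute:
  assumes "bij \<pi>"
  shows "FS (x \<circ> \<pi>) = FS x"
proof -
  have eq: "sum (x \<circ> \<pi>) F = sum x (\<pi> ` F)" for F
    using assms by (subst sum.reindex) (auto simp: bij_def inj_on_def)
  show ?thesis
  proof (intro equalityI subsetI)
    fix y assume "y \<in> FS (x \<circ> \<pi>)"
    then obtain F where "finite F" "F \<noteq> {}" "y = sum x (\<pi> ` F)"
      unfolding FS_def eq by blast
    then show "y \<in> FS x"
      unfolding FS_def by (intro CollectI exI[of _ "\<pi> ` F"]) simp
  next
    fix y assume "y \<in> FS x"
    then obtain F where "finite F" "F \<noteq> {}" "y = sum x F"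
      unfolding FS_def by blast
    moreover have "\<pi> ` inv \<pi> ` F = F"
      using assms by (simp add: image_f_inv_f bij_is_surj)
    ultimately show "y \<in> FS (x \<circ> \<pi>)"
      unfolding FS_def eq by (intro CollectI exI[of _ "inv \<pi> ` F"]) simp
  qed
qed

lemma inj_nat_sort:
  fixes f :: "nat \<Rightarrow> nat"
  assumes "inj f"
  obtains \<pi> :: "nat \<Rightarrow> nat" where "bij \<pi>" "strict_mono (f \<circ> \<pi>)"
proof -
  have inf: "infinite (range f)"
    using assms by (simp add: finite_image_iff)
  define \<pi> where "\<pi> = the_inv f \<circ> enumerate (range f)"
  have f: "f \<circ> \<pi> = enumerate (range f)"
    using assms enumerate_in_set[OF inf]
    by (auto simp: \<pi>_def fun_eq_iff intro!: f_the_inv_into_f)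
  have "bij_betw (the_inv f) (range f) UNIV"
    using assms by (simp add: bij_betw_the_inv_into inj_on_imp_bij_betw)
  then have "bij \<pi>"
    unfolding \<pi>_def using bij_enumerate[OF inf] bij_betw_trans by blast
  moreover have "strict_mono (f \<circ> \<pi>)"
    unfolding f using inf by (simp add: strict_mono_enumerate)
  ultimately show thesis by (rule that)
qed

section \<open>Strongly summable ultrafilters\<close>

lemma ultrafilter_finite_colouring:
  assumes U: "ultrafilter U" and f: "finite (range f)"
  obtains c where "\<forall>\<^sub>F x in U. f x = c"
proof -
  have "\<exists>c. \<forall>\<^sub>F x in U. f x = c"
  proof (rule ccontr)
    assume "\<not> ?thesis"
    then have "\<forall>c\<in>range f. \<forall>\<^sub>F x in U. f x \<noteq> c"
      using U by (auto simp: ultrafilter_def)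
    then have "\<forall>\<^sub>F x in U. \<forall>c\<in>range f. f x \<noteq> c"
      by (intro eventually_ball_finite f)
    then have "\<forall>\<^sub>F x in U. False" by (rule eventually_mono) auto
    then show False
      using U by (simp add: ultrafilter_def)
  qed
  then show thesis using that by blast
qed

lemma ultrafilter_le_imp_eq:
  assumes "ultrafilter U" "ultrafilter V" "U \<le> V"
  shows "U = V"
proof (rule antisym)
  show "V \<le> U"
  proof (rule filter_leI)
    fix P assume P: "eventually P U"
    show "eventually P V"
    proof (rule ccontr)
      assume "\<not> eventually P V"
      then have "\<forall>\<^sub>F x in U. \<not> P x"
        using assms by (auto simp: ultrafilter_def le_filter_def)
      with P have "\<forall>\<^sub>F x in U. False" by eventually_elim simp
      then show False using assms by (simp add: ultrafilter_def)
    qed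
  qed
qed fact

lemma strongly_summable_obtain_FS:
  assumes "strongly_summable U" "eventually P U"
  obtains x where "inj x" "\<And>y. y \<in> FS x \<Longrightarrow> P y" "\<forall>\<^sub>F y in U. y \<in> FS x"
proof -
  have "\<forall>\<^sub>F y in U. y \<in> {y. P y}" using assms(2) by simp
  then show thesis
    using assms(1) that unfolding strongly_summable_def by blast
qed

lemma in_FS_1 [intro, simp]: "x i \<in> FS x"
  by (auto simp: FS_def intro!: exI[of _ "{i}"])

lemma in_FS_2: "i \<noteq> j \<Longrightarrow> x i + x j \<in> FS x"
  by (auto simp: FS_def intro!: exI[of _ "{i, j}"])

lemma strongly_summable_nonzero:
  assumes "strongly_summable U"
  shows "\<forall>\<^sub>F y in U. y \<noteq> 0"
proof (rule ccontr)
  assume "\<not> ?thesis"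
  then have "\<forall>\<^sub>F y in U. y = 0"
    using assms unfolding strongly_summable_def ultrafilter_def by fastforce
  with assms obtain x where x: "inj x" "\<And>y. y \<in> FS x \<Longrightarrow> y = 0"
    by (rule strongly_summable_obtain_FS) blast
  from x(2) have "x 0 = x 1" by (metis in_FS_1)
  with x(1) show False by (simp add: inj_eq)
qed

text \<open>The residue class modulo \<open>m\<close> chosen by the ultrafilter contains two integers along with
  their sum, so it is idempotent in the group \<open>\<int>/m\<close>, where only \<open>0\<close> is.\<close>

lemma strongly_summable_dvd:
  assumes U: "strongly_summable U" and m: "m > 0"
  shows "\<forall>\<^sub>F y in U. m dvd y"
proof -
  have "range (\<lambda>y. y mod m) \<subseteq> {0..<m}" using m by auto
  then have "finite (range (\<lambda>y. y mod m))" by (rule finite_subset) simp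
  with U obtain c where c: "\<forall>\<^sub>F y in U. y mod m = c"
    using ultrafilter_finite_colouring[of U "\<lambda>y. y mod m"]
    unfolding strongly_summable_def by blast
  with U obtain x where x: "\<And>y. y \<in> FS x \<Longrightarrow> y mod m = c"
    by (rule strongly_summable_obtain_FS) blast
  have "x 0 mod m = c" "x 1 mod m = c" "(x 0 + x 1) mod m = c"
    by (auto intro!: x in_FS_2)
  then have "(x 0 + x 1) mod m = x 0 mod m" by simp
  then have "m dvd x 1" by (simp add: mod_eq_dvd_iff)
  then have "c = 0" using \<open>x 1 mod m = c\<close> by auto
  with c show ?thesis by (auto elim: eventually_mono)
qed

definition FS_from :: "nat \<Rightarrow> (nat \<Rightarrow> int) \<Rightarrow> int set" where
  "FS_from k x = {sum x F |F. finite F \<and> F \<noteq> {} \<and> F \<subseteq> {k..}}"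

definition last_digit :: "int \<Rightarrow> int \<Rightarrow> int" where
  "last_digit q y = (y div q ^ multiplicity q y) mod q"

text \<open>If the valuations agree, no carry reaches the last nonzero digit, so the sum of two integers
  with last digit \<open>c\<close> has last digit \<open>2c\<close>, which is neither \<open>0\<close> nor \<open>c\<close> modulo an odd prime.\<close>

lemma last_digit_add_distinct:
  fixes q :: int
  assumes q: "prime q" "q > 2" and nz: "y \<noteq> 0" "z \<noteq> 0"
    and mult: "multiplicity q y = multiplicity q z"
    and dig: "last_digit q y = c" "last_digit q z = c"
  shows "last_digit q (y + z) \<noteq> c"
proof -
  define e where "e = multiplicity q y"
  have unit: "\<not> q dvd 1" using q by (simp add: not_prime_unit)
  obtain u where u: "y = q ^ e * u" "\<not> q dvd u"
    using multiplicity_decompose'[of y q] nz unit unfolding e_def by metis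
  obtain v where v: "z = q ^ e * v" "\<not> q dvd v"
    using multiplicity_decompose'[of z q] nz unit unfolding e_def mult by metis
  have "last_digit q y = (q ^ e * u) div q ^ e mod q" "last_digit q z = (q ^ e * v) div q ^ e mod q"
    unfolding last_digit_def mult[symmetric] e_def[symmetric] by (simp_all add: u(1) v(1))
  then have uv: "u mod q = c" "v mod q = c"
    using dig q by simp_all
  have "q dvd u - v" using uv by (simp add: mod_eq_dvd_iff[symmetric])
  have "\<not> q dvd u + v"
  proof
    assume "q dvd u + v"
    with \<open>q dvd u - v\<close> have "q dvd 2 * u"
      using dvd_add[of q "u + v" "u - v"] by simp
    then have "q dvd 2" using u q by (simp add: prime_dvd_mult_iff)
    with q show False using zdvd_imp_le[of q 2] by simp
  qed
  moreover have yz: "y + z = q ^ e * (u + v)" using u v by (simp add: algebra_simps)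
  ultimately have "multiplicity q (y + z) = e"
    using q unit by (intro multiplicity_eqI) (auto simp: mult.assoc)
  then have "last_digit q (y + z) = (u + v) mod q"
    using q by (simp add: last_digit_def yz)
  moreover have "(u + v) mod q \<noteq> v mod q"
    using u by (simp add: mod_eq_dvd_iff)
  ultimately show ?thesis using uv by simp
qed

text \<open>Distinct valuations are inherited by every reordering of the sequence, while \<open>FS x\<close> does not
  depend on the order; so the terms may be sorted by valuation.\<close>

lemma strongly_summable_thin:
  fixes q :: int
  assumes U: "strongly_summable U" and q: "prime q" "q > 2" and P: "eventually P U"
  obtains x where "\<And>n. x n \<noteq> 0" "strict_mono (\<lambda>n. multiplicity q (x n))"
    "\<And>y. y \<in> FS x \<Longrightarrow> P y" "\<And>k. \<forall>\<^sub>F y in U. y \<in> FS_from k x"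
proof -
  have "range (last_digit q) \<subseteq> {0..<q}" using q by (auto simp: last_digit_def)
  then have "finite (range (last_digit q))" by (rule finite_subset) simp
  with U obtain c where c: "\<forall>\<^sub>F y in U. last_digit q y = c"
    using ultrafilter_finite_colouring[of U "last_digit q"]
    unfolding strongly_summable_def by blast
  have "\<forall>\<^sub>F y in U. P y \<and> y \<noteq> 0 \<and> last_digit q y = c"
    using P c strongly_summable_nonzero[OF U] by eventually_elim simp
  with U obtain x0 where x0: "inj x0"
      "\<And>y. y \<in> FS x0 \<Longrightarrow> P y \<and> y \<noteq> 0 \<and> last_digit q y = c" "\<forall>\<^sub>F y in U. y \<in> FS x0"
    by (rule strongly_summable_obtain_FS) blast
  have "inj (\<lambda>n. multiplicity q (x0 n))"
  proof (rule injI, rule ccontr)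
    fix i j assume "multiplicity q (x0 i) = multiplicity q (x0 j)" "i \<noteq> j"
    then have "last_digit q (x0 i + x0 j) \<noteq> c"
      using x0(2) by (intro last_digit_add_distinct q) auto
    then show False using x0(2) in_FS_2[OF \<open>i \<noteq> j\<close>] by blast
  qed
  then obtain \<pi> :: "nat \<Rightarrow> nat" where \<pi>: "bij \<pi>" "strict_mono ((\<lambda>n. multiplicity q (x0 n)) \<circ> \<pi>)"
    by (rule inj_nat_sort)
  define x where "x = x0 \<circ> \<pi>"
  have FS: "FS x = FS x0" using \<pi>(1) by (simp add: x_def FS_permute)
  have mono: "strict_mono (\<lambda>n. multiplicity q (x n))"
    using \<pi>(2) by (simp add: x_def comp_def)
  have nz: "x n \<noteq> 0" for n
    using x0(2) FS by (metis in_FS_1)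
  show thesis
  proof
    show "x n \<noteq> 0" for n by (rule nz)
    show "strict_mono (\<lambda>n. multiplicity q (x n))" by (rule mono)
    show "P y" if "y \<in> FS x" for y using that x0(2) FS by blast
    fix k
    \<comment> \<open>A sum over \<open>F\<close> that is divisible by \<open>q ^ N\<close> cannot involve an index below \<open>k\<close>: its coefficient
      \<open>1\<close> would have to vanish.\<close>
    define N where "N = multiplicity q (x k)"
    have "\<forall>\<^sub>F y in U. q ^ N dvd y"
      using q by (intro strongly_summable_dvd U) simp
    with x0(3) show "\<forall>\<^sub>F y in U. y \<in> FS_from k x"
    proof eventually_elim
      fix y assume "y \<in> FS x0" and dvd: "q ^ N dvd y"
      then have "y \<in> FS x" unfolding FS by simp
      then obtain F where F: "finite F" "F \<noteq> {}" "y = sum x F"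
        unfolding FS_def by blast
      have "k \<le> i" if i: "i \<in> F" for i
      proof (rule ccontr)
        assume "\<not> k \<le> i"
        then have "multiplicity q (x i) < N"
          using mono by (simp add: strict_mono_def N_def)
        then have "(1::int) = 0"
          using dvd F q i
          by (intro thin_sequence_independent[OF q(1) mono nz F(1), of "\<lambda>_. 1" N i]) auto
        then show False by simp
      qed
      with F show "y \<in> FS_from k x" by (auto simp: FS_from_def)
    qed
  qed
qed

text \<open>Adding to a sum over \<open>F\<close> any sum over indices beyond \<open>F\<close> stays inside \<open>FS x\<close>, and the latter
  sums form a set of the ultrafilter.\<close>

theorem strongly_summable_imp_idempotent:
  assumes U: "strongly_summable U"
  shows "uf_idempotent U"
proof -
  have uf: "ultrafilter U" using U by (simp add: strongly_summable_def)
  have "U \<oplus>\<^sub>u U \<le> U"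
  proof (rule filter_leI)
    fix P assume P: "eventually P U"
    have three: "prime (3::int)" by simp
    obtain x where x: "\<And>y. y \<in> FS x \<Longrightarrow> P y" "\<And>k. \<forall>\<^sub>F y in U. y \<in> FS_from k x"
      by (rule strongly_summable_thin[OF U three _ P], simp) blast
    have "\<forall>\<^sub>F n in U. \<forall>\<^sub>F k in U. P (n + k)"
      using x(2)[of 0]
    proof eventually_elim
      fix n assume "n \<in> FS_from 0 x"
      then obtain F where F: "finite F" "F \<noteq> {}" "n = sum x F"
        by (auto simp: FS_from_def)
      show "\<forall>\<^sub>F k in U. P (n + k)"
        using x(2)[of "Suc (Max F)"]
      proof eventually_elim
        fix k assume "k \<in> FS_from (Suc (Max F)) x"
        then obtain G where G: "finite G" "G \<noteq> {}" "G \<subseteq> {Suc (Max F)..}" "k = sum x G"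
          by (auto simp: FS_from_def)
        have "F \<inter> G = {}" using F(1) G(3) Max_ge by (fastforce simp: Suc_le_eq)
        then have "n + k = sum x (F \<union> G)"
          using F G by (simp add: sum.union_disjoint)
        then have "n + k \<in> FS x" using F G by (auto simp: FS_def)
        then show "P (n + k)" by (rule x(1))
      qed
    qed
    then show "eventually P (U \<oplus>\<^sub>u U)" by (simp add: eventually_uf_plus)
  qed
  then show ?thesis
    unfolding uf_idempotent_def by (intro ultrafilter_le_imp_eq ultrafilter_uf_plus uf)
qed

section \<open>Equivalent strings and solutions in their classes\<close>

lemma uf_scale_plus: "uf_scale a (U \<oplus>\<^sub>u V) = uf_scale a U \<oplus>\<^sub>u uf_scale a V"
  by (simp add: filter_eq_iff uf_scale_def eventually_filtermap eventually_uf_plus distrib_left)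

lemma string_uf_cong:
  assumes "\<sigma> \<approx>\<^sub>s \<tau>" "ultrafilter U" "uf_idempotent U"
  shows "string_uf \<sigma> U = string_uf \<tau> U"
  using assms(1)
proof induction
  case empty_zero
  show ?case using assms(2)
    by (simp add: filter_eq_iff uf_scale_def eventually_filtermap eventually_principal ultrafilter_def)
next
  case (dup a)
  show ?case using assms(3) by (simp add: uf_idempotent_def flip: uf_scale_plus)
qed (simp_all add: string_uf_append)

text \<open>The iterated quantifier \<open>\<forall>\<^sub>F n\<^sub>1 in U. \<dots> \<forall>\<^sub>F n\<^sub>l in U\<close> hidden in each \<open>string_uf (s i) U\<close> binds the
  same kind of variables for all \<open>i\<close>, so a single choice of \<open>n\<^sub>1, \<dots>, n\<^sub>l\<close> works simultaneously.\<close>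

lemma string_uf_common_witness:
  assumes "U \<noteq> bot" and "\<And>i. i < m \<Longrightarrow> length (s i) = l"
    and "\<And>i. i < (m::nat) \<Longrightarrow> eventually (P i) (string_uf (s i) U)"
  shows "\<exists>n :: nat \<Rightarrow> int. \<forall>i<m. P i (\<Sum>j<l. s i ! j * n j)"
  using assms(2,3)
proof (induction l arbitrary: s P)
  case 0
  then show ?case by (auto simp: eventually_principal)
next
  case (Suc l)
  have s: "s i = hd (s i) # tl (s i)" if "i < m" for i
    using Suc.prems(1)[OF that] by (cases "s i") auto
  have "\<forall>\<^sub>F n in U. \<forall>\<^sub>F k in string_uf (tl (s i)) U. P i (hd (s i) * n + k)" if "i < m" for i
  proof -
    have "eventually (P i) (string_uf (hd (s i) # tl (s i)) U)"
      using Suc.prems(2)[OF that] s[OF that] by simp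
    then show ?thesis by (simp add: eventually_uf_plus uf_scale_def eventually_filtermap)
  qed
  then have "\<forall>\<^sub>F n in U. \<forall>i\<in>{..<m}. \<forall>\<^sub>F k in string_uf (tl (s i)) U. P i (hd (s i) * n + k)"
    by (intro eventually_ball_finite) auto
  with assms(1) obtain n0 where
    n0: "\<And>i. i < m \<Longrightarrow> \<forall>\<^sub>F k in string_uf (tl (s i)) U. P i (hd (s i) * n0 + k)"
    using eventually_happens by fastforce
  obtain n where n: "\<forall>i<m. P i (hd (s i) * n0 + (\<Sum>j<l. tl (s i) ! j * n j))"
    using Suc.IH[of "\<lambda>i. tl (s i)" "\<lambda>i k. P i (hd (s i) * n0 + k)"] Suc.prems(1) n0 by auto
  have "(\<Sum>j<Suc l. s i ! j * case_nat n0 n j) = hd (s i) * n0 + (\<Sum>j<l. tl (s i) ! j * n j)"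
    if "i < m" for i
    by (subst s[OF that]) (simp add: sum.lessThan_Suc_shift del: sum.lessThan_Suc)
  with n show ?case by (intro exI[of _ "case_nat n0 n"]) simp
qed

lemma uf_models_if_solution:
  assumes sol: "has_solution_in_class m c \<sigma>" and U: "ultrafilter U" "uf_idempotent U"
  shows "uf_models (string_uf \<sigma> U) m (linear_form m c)"
  unfolding uf_models_def
proof (intro allI impI)
  fix A assume A: "\<forall>\<^sub>F x in string_uf \<sigma> U. x \<in> A"
  from sol obtain s l where s: "\<And>i. i < m \<Longrightarrow> \<sigma> \<approx>\<^sub>s s i" "\<And>i. i < m \<Longrightarrow> length (s i) = l"
    and z: "\<And>j. j < l \<Longrightarrow> (\<Sum>i<m. c i * s i ! j) = 0"
    unfolding has_solution_in_class_def str_class_def by blast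
  have "\<forall>\<^sub>F x in string_uf (s i) U. x \<in> A" if "i < m" for i
    using A string_uf_cong[OF s(1)[OF that] U] by simp
  then obtain n where n: "\<forall>i<m. (\<Sum>j<l. s i ! j * n j) \<in> A"
    using string_uf_common_witness[of U m s l "\<lambda>_ x. x \<in> A"] s(2) U(1)
    by (auto simp: ultrafilter_def)
  have "linear_form m c (\<lambda>i. \<Sum>j<l. s i ! j * n j) = (\<Sum>i<m. \<Sum>j<l. c i * s i ! j * n j)"
    by (simp add: linear_form_def sum_distrib_left mult.assoc)
  also have "\<dots> = (\<Sum>j<l. (\<Sum>i<m. c i * s i ! j) * n j)"
    by (subst sum.swap) (simp add: sum_distrib_right)
  also have "\<dots> = 0" using z by simp
  finally have "linear_form m c (\<lambda>i. \<Sum>j<l. s i ! j * n j) = 0" .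
  with n show "\<exists>b. (\<forall>i<m. b i \<in> A) \<and> linear_form m c b = 0"
    by (intro exI[of _ "\<lambda>i. \<Sum>j<l. s i ! j * n j"] conjI)
qed

section \<open>Extracting a solution from a strongly summable ultrafilter\<close>

lemma str_equiv_set: "\<sigma> \<approx>\<^sub>s \<tau> \<Longrightarrow> set \<sigma> - {0} = set \<tau> - {0}"
  by (induction rule: str_equiv.induct) auto

lemma str_equiv_zero_Cons: "0 # \<sigma> \<approx>\<^sub>s \<sigma>"
  using str_equiv.append[OF str_equiv.sym[OF str_equiv.empty_zero] str_equiv.refl[of \<sigma>]] by simp

lemma str_equiv_pad: "\<sigma> @ replicate n 0 \<approx>\<^sub>s \<sigma>"
proof -
  have "replicate n 0 \<approx>\<^sub>s []"
    by (induction n) (auto intro: str_equiv.refl str_equiv.trans[OF str_equiv_zero_Cons])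
  from str_equiv.append[OF str_equiv.refl this] show ?thesis by fastforce
qed

lemma str_equiv_constant_block:
  assumes "set w \<subseteq> {0, a}"
  shows "w \<approx>\<^sub>s [] \<or> w \<approx>\<^sub>s [a]"
  using assms
proof (induction w)
  case Nil
  show ?case by (simp add: str_equiv.refl)
next
  case (Cons b w)
  then have IH: "w \<approx>\<^sub>s [] \<or> w \<approx>\<^sub>s [a]" and "b = 0 \<or> b = a" by auto
  have ap: "b # w \<approx>\<^sub>s b # w'" if "w \<approx>\<^sub>s w'" for w'
    using str_equiv.append[OF str_equiv.refl[of "[b]"] that] by simp
  show ?case
  proof (cases "b = 0")
    case True
    with IH show ?thesis using str_equiv.trans[OF str_equiv_zero_Cons] by blast
  next
    case False
    with \<open>b = 0 \<or> b = a\<close> have b: "b = a" by simp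
    from IH show ?thesis
    proof
      assume "w \<approx>\<^sub>s []"
      from ap[OF this] show ?thesis by (simp add: b)
    next
      assume "w \<approx>\<^sub>s [a]"
      from str_equiv.trans[OF ap[OF this] str_equiv.sym] str_equiv.dup[of a]
      show ?thesis by (simp add: b)
    qed
  qed
qed

text \<open>A nonzero letter \<open>a\<close> survives in \<open>w\<close>, since \<open>\<approx>\<^sub>s\<close> preserves the set of nonzero letters.\<close>

lemma str_equiv_block:
  assumes "set w \<subseteq> {0, a}" "a \<in> set w"
  shows "w \<approx>\<^sub>s [a]"
proof (cases "a = 0")
  case True
  with str_equiv_constant_block[OF assms(1)] show ?thesis
    using str_equiv.empty_zero str_equiv.trans by blast
next
  case False
  then have "\<not> w \<approx>\<^sub>s []" using assms(2) str_equiv_set by fastforce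
  with str_equiv_constant_block[OF assms(1)] show ?thesis by blast
qed

text \<open>Evaluating a string against \<open>x k, x (k + 1), \<dots>\<close>; the offset allows strings to be concatenated.\<close>

definition word_value :: "(nat \<Rightarrow> int) \<Rightarrow> nat \<Rightarrow> int list \<Rightarrow> int" where
  "word_value x k w = (\<Sum>j<length w. w ! j * x (k + j))"

lemma word_value_Nil [simp]: "word_value x k [] = 0"
  by (simp add: word_value_def)

lemma word_value_Cons [simp]: "word_value x k (b # w) = b * x k + word_value x (Suc k) w"
  by (simp add: word_value_def sum.lessThan_Suc_shift del: sum.lessThan_Suc)

lemma word_value_append:
  "word_value x k (v @ w) = word_value x k v + word_value x (k + length v) w"
  by (induction v arbitrary: k) auto

lemma word_value_zeros [simp]: "word_value x k (replicate n 0) = 0"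
  by (induction n arbitrary: k) auto

lemma word_value_map_upt:
  "k \<le> l \<Longrightarrow> word_value x k (map f [k..<l]) = (\<Sum>j=k..<l. f j * x j)"
proof (induction l rule: dec_induct)
  case (step l)
  then show ?case by (simp add: word_value_append)
qed simp

text \<open>Each summand \<open>a\<U>\<close> contributes \<open>a\<close> times a finite sum over indices \<open>F\<close>, that is, a block
  consisting of letters \<open>a\<close> and \<open>0\<close>. By the order of the quantifiers in a sum of ultrafilters the
  later summands may use indices beyond \<open>F\<close> only, so the blocks simply follow one another.\<close>

lemma eventually_word_values:
  assumes tails: "\<And>k. \<forall>\<^sub>F y in U. y \<in> FS_from k x"
  shows "\<forall>\<^sub>F y in string_uf \<sigma> U. \<exists>w. \<sigma> \<approx>\<^sub>s w \<and> y = word_value x k w"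
proof (induction \<sigma> arbitrary: k)
  case Nil
  show ?case
    by (auto simp: eventually_principal intro: exI[of _ "[]"] str_equiv.refl)
next
  case (Cons a \<sigma>)
  have "\<forall>\<^sub>F n in U. \<forall>\<^sub>F r in string_uf \<sigma> U. \<exists>w. a # \<sigma> \<approx>\<^sub>s w \<and> a * n + r = word_value x k w"
    using tails[of k]
  proof eventually_elim
    fix n assume "n \<in> FS_from k x"
    then obtain F where F: "finite F" "F \<noteq> {}" "F \<subseteq> {k..}" "n = sum x F"
      by (auto simp: FS_from_def)
    define l where "l = Suc (Max F)"
    have Fl: "F \<subseteq> {k..<l}"
      using F by (auto simp: l_def less_Suc_eq_le)
    then have kl: "k \<le> l" using F(2) by fastforce
    define v where "v = map (\<lambda>j. if j \<in> F then a else 0) [k..<l]"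
    have v: "v \<approx>\<^sub>s [a]"
      using F(2) Fl by (intro str_equiv_block) (auto simp: v_def image_iff)
    have "word_value x k v = (\<Sum>j=k..<l. if j \<in> F then a * x j else 0)"
      unfolding v_def word_value_map_upt[OF kl] by (intro sum.cong) auto
    also have "\<dots> = a * n"
      using Fl by (simp add: sum.If_cases Int_absorb1 F(4) sum_distrib_left)
    finally have val: "word_value x k v = a * n" .
    show "\<forall>\<^sub>F r in string_uf \<sigma> U. \<exists>w. a # \<sigma> \<approx>\<^sub>s w \<and> a * n + r = word_value x k w"
      using Cons.IH[of l]
    proof eventually_elim
      fix r assume "\<exists>w. \<sigma> \<approx>\<^sub>s w \<and> r = word_value x l w"
      then obtain w where w: "\<sigma> \<approx>\<^sub>s w" "r = word_value x l w" by blast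
      have "a # \<sigma> \<approx>\<^sub>s v @ w"
        using str_equiv.append[OF str_equiv.sym[OF v] w(1)] by simp
      moreover have "word_value x k (v @ w) = a * n + r"
        using kl by (simp add: word_value_append val w(2)) (simp add: v_def)
      ultimately show "\<exists>w. a # \<sigma> \<approx>\<^sub>s w \<and> a * n + r = word_value x k w"
        by metis
    qed
  qed
  then show ?case by (simp add: eventually_uf_plus uf_scale_def eventually_filtermap)
qed

lemma solution_if_strongly_summable_models:
  assumes U: "strongly_summable U" and models: "uf_models (string_uf \<sigma> U) m (linear_form m c)"
  shows "has_solution_in_class m c \<sigma>"
proof -
  \<comment> \<open>\<open>M\<close> bounds the letters of all strings in the class of \<open>\<sigma>\<close>, and \<open>K\<close> the coefficients \<open>d j\<close> below.
    Both are independent of \<open>x\<close>, so \<open>q\<close> can be chosen first.\<close>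
  define M where "M = sum_list (map abs \<sigma>)"
  define K where "K = (\<Sum>i<m. \<bar>c i\<bar> * M)"
  have M: "\<bar>a\<bar> \<le> M" if "\<sigma> \<approx>\<^sub>s w" "a \<in> set w" for a w
  proof (cases "a = 0")
    case True
    then show ?thesis by (auto simp: M_def intro!: sum_list_nonneg)
  next
    case False
    with that have "a \<in> set \<sigma>" using str_equiv_set by blast
    then show ?thesis unfolding M_def by (intro member_le_sum_list) auto
  qed
  obtain p where "prime p" "nat (max K 2) < p"
    using bigger_prime by blast
  define q where "q = int p"
  have q: "prime q" "q > 2" "q > K"
    using \<open>prime p\<close> \<open>nat (max K 2) < p\<close> by (auto simp: q_def)
  obtain x where nz: "\<And>n. x n \<noteq> 0" and mono: "strict_mono (\<lambda>n. multiplicity q (x n))"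
    and tails: "\<And>k. \<forall>\<^sub>F y in U. y \<in> FS_from k x"
    using strongly_summable_thin[OF U q(1,2), of "\<lambda>_. True"] by auto
  have "\<forall>\<^sub>F y in string_uf \<sigma> U. y \<in> {y. \<exists>w. \<sigma> \<approx>\<^sub>s w \<and> y = word_value x 0 w}"
    using eventually_word_values[OF tails] by simp
  then obtain b where "\<forall>i<m. b i \<in> {y. \<exists>w. \<sigma> \<approx>\<^sub>s w \<and> y = word_value x 0 w}"
    and b0: "linear_form m c b = 0"
    using models unfolding uf_models_def by blast
  then obtain w where w: "\<And>i. i < m \<Longrightarrow> \<sigma> \<approx>\<^sub>s w i" "\<And>i. i < m \<Longrightarrow> b i = word_value x 0 (w i)"
    by simp metis
  \<comment> \<open>Padding with zeros yields strings of a common length.\<close>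
  define l where "l = (\<Sum>i<m. length (w i))"
  define s where "s i = w i @ replicate (l - length (w i)) 0" for i
  have s: "\<sigma> \<approx>\<^sub>s s i" "length (s i) = l" "b i = (\<Sum>j<l. s i ! j * x j)" if "i < m" for i
  proof -
    show "\<sigma> \<approx>\<^sub>s s i"
      unfolding s_def using w(1)[OF that] str_equiv_pad str_equiv.sym str_equiv.trans by blast
    have "length (w i) \<le> l"
      unfolding l_def using that by (intro member_le_sum) auto
    then show "length (s i) = l" by (simp add: s_def)
    moreover have "b i = word_value x 0 (s i)"
      using w(2)[OF that] by (simp add: s_def word_value_append)
    ultimately show "b i = (\<Sum>j<l. s i ! j * x j)"
      by (simp add: word_value_def)
  qed
  define d where "d j = (\<Sum>i<m. c i * s i ! j)" for j
  have bound: "\<bar>d j\<bar> < q" if "j < l" for j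
  proof -
    have "\<bar>d j\<bar> \<le> (\<Sum>i<m. \<bar>c i * s i ! j\<bar>)"
      unfolding d_def by (rule sum_abs)
    also have "\<dots> \<le> K"
      unfolding K_def
    proof (rule sum_mono)
      fix i assume "i \<in> {..<m}"
      with that s(2) have "s i ! j \<in> set (s i)" by simp
      then have "\<bar>s i ! j\<bar> \<le> M"
        using s(1) \<open>i \<in> {..<m}\<close> by (intro M) auto
      then show "\<bar>c i * s i ! j\<bar> \<le> \<bar>c i\<bar> * M"
        by (simp add: abs_mult mult_left_mono)
    qed
    finally show ?thesis using q(3) by simp
  qed
  have "0 = (\<Sum>i<m. \<Sum>j<l. c i * s i ! j * x j)"
    using b0 s(3) by (simp add: linear_form_def sum_distrib_left mult.assoc)
  also have "\<dots> = (\<Sum>j<l. d j * x j)"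
    unfolding d_def by (subst sum.swap) (simp add: sum_distrib_right)
  finally have rel: "(\<Sum>j<l. d j * x j) = 0" by simp
  have "d j = 0" if "j < l" for j
    using that bound rel
    by (intro thin_sequence_independent[OF q(1) mono nz finite_lessThan[of l],
          where N = "Suc (multiplicity q (x j))"]) auto
  with s show ?thesis
    unfolding has_solution_in_class_def str_class_def d_def by blast
qed

theorem theorem4p3:
  fixes m :: nat and c :: "nat \<Rightarrow> int" and \<sigma> :: "int list"
  assumes ESS: "\<exists>U. strongly_summable U"
    and "reduced \<sigma>"
  shows "((\<forall>U. ultrafilter U \<longrightarrow> uf_idempotent U \<longrightarrow>
              uf_models (string_uf \<sigma> U) m (linear_form m c))
          \<longleftrightarrow> (\<exists>U. strongly_summable U \<and> uf_models (string_uf \<sigma> U) m (linear_form m c)))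
       \<and> ((\<exists>U. strongly_summable U \<and> uf_models (string_uf \<sigma> U) m (linear_form m c))
          \<longleftrightarrow> has_solution_in_class m c \<sigma>)"
    (is "(?all \<longleftrightarrow> ?some) \<and> (?some \<longleftrightarrow> ?sol)")
proof -
  have "?some" if ?all
    using ESS that strongly_summable_imp_idempotent unfolding strongly_summable_def by blast
  moreover have ?sol if ?some
    using that solution_if_strongly_summable_models by blast
  moreover have ?all if ?sol
    using that uf_models_if_solution by blast
  ultimately show ?thesis by blast
qed

end
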